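(* Let $s\geq 1$ and $n>2s$ be integers, and let $G$ be a graph of order $n$ with complement $\overline{G}$. Then \[ \sum_{i=1}^{s}\left(\mu_{n-i+1}^2(G)+\mu_{n-i+1}^2(\overline{G})\right)\leq\left(\frac{n}{2}+s\right)^2. \]
   Context: Graphs are finite and simple. For a graph $G$ of order $n$, $\mu_1(G)\geq\mu_2(G)\geq\cdots\geq\mu_n(G)$ denote the eigenvalues of its adjacency matrix, and $\overline{G}$ denotes the complement of $G$. *)

theory Defs
  imports "Graph_Theory.Pair_Digraph" "Jordan_Normal_Form.Char_Poly"
    "Jordan_Normal_Form.Conjugate"
begin

text \<open>A finite simple graph is a \<^const>\<open>pair_graph\<close>: a finite vertex set with a symmetric
  irreflexive set of arcs, each undirected edge being represented by its two orientations.\<close>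

definition complement_graph :: "'a pair_pre_digraph \<Rightarrow> 'a pair_pre_digraph" where
  "complement_graph G =
    \<lparr> pverts = pverts G,
      parcs = {(u, v). u \<in> pverts G \<and> v \<in> pverts G \<and> u \<noteq> v \<and> (u, v) \<notin> parcs G} \<rparr>"

lemma pair_graph_complement_graph:
  assumes "pair_graph G"
  shows "pair_graph (complement_graph G)"
proof -
  interpret pair_graph G by fact
  have sub: "parcs (complement_graph G) \<subseteq> pverts G \<times> pverts G"
    by (auto simp: complement_graph_def)
  have fin: "finite (parcs (complement_graph G))"
    using finite_subset[OF sub] pair_finite_verts by blast
  show ?thesis
    using fin pair_finite_verts pair_sym_arcs
    by unfold_locales
      (auto simp: complement_graph_def symmetric_def sym_def)
qed

definition adjacency_matrix_wrt :: "'a list \<Rightarrow> 'a pair_pre_digraph \<Rightarrow> real mat" where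
  "adjacency_matrix_wrt vs G =
    mat (length vs) (length vs) (\<lambda>(i, j). if (vs ! i, vs ! j) \<in> parcs G then 1 else 0)"

definition adjacency_matrix :: "'a pair_pre_digraph \<Rightarrow> real mat" where
  "adjacency_matrix G = adjacency_matrix_wrt (SOME vs. distinct vs \<and> set vs = pverts G) G"

text \<open>\<open>graph_eigenvalue G i\<close> is the \<open>i\<close>-th largest eigenvalue of the adjacency matrix, with
  algebraic multiplicity, for \<open>1 \<le> i \<le> card (pverts G)\<close>; it is meaningless for other \<open>i\<close>.
  That it depends only on \<open>G\<close> and that the list has \<open>card (pverts G)\<close> entries is shown below.\<close>

definition graph_eigenvalues :: "'a pair_pre_digraph \<Rightarrow> real list" where
  "graph_eigenvalues G = rev (sorted_list_of_multiset (proots (char_poly (adjacency_matrix G))))"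

definition graph_eigenvalue :: "'a pair_pre_digraph \<Rightarrow> nat \<Rightarrow> real" where
  "graph_eigenvalue G i = graph_eigenvalues G ! (i - 1)"

lemma char_poly_adjacency_matrix_wrt:
  assumes "distinct vs" "distinct ws" "set vs = set ws"
  shows "char_poly (adjacency_matrix_wrt vs G) = char_poly (adjacency_matrix_wrt ws G)"
proof -
  let ?n = "length ws"
  have "mset vs = mset ws"
    using assms set_eq_iff_mset_eq_distinct by blast
  then obtain p where p: "p permutes {..<?n}" and vs: "permute_list p ws = vs"
    using mset_eq_permutation by metis
  have p': "p permutes {0..<?n}"
    using p by (simp add: atLeast0LessThan)
  have len: "length vs = ?n"
    using vs by auto
  have nth: "vs ! i = ws ! p i" if "i < ?n" for i
    using permute_list_nth[OF p that] vs by simp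
  have pl: "p i < ?n" if "i < ?n" for i
    using permutes_in_image[OF p, of i] that by simp
  have pinj: "p i = p j \<longleftrightarrow> i = j" for i j
    using permutes_inj[OF p] by (auto dest: injD)
  define A where "A = char_poly_matrix (adjacency_matrix_wrt ws G)"
  define B where "B = mat ?n ?n (\<lambda>(i, j). A $$ (p i, j))"
  have A: "A \<in> carrier_mat ?n ?n"
    by (simp add: A_def adjacency_matrix_wrt_def)
  have B: "B \<in> carrier_mat ?n ?n"
    by (simp add: B_def)
  have "char_poly_matrix (adjacency_matrix_wrt vs G)
      = transpose_mat (mat ?n ?n (\<lambda>(i, j). transpose_mat B $$ (p i, j)))"
    by (rule eq_matI)
      (auto simp: char_poly_matrix_def A_def B_def adjacency_matrix_wrt_def len nth pl pinj)
  then have "char_poly (adjacency_matrix_wrt vs G)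
      = det (mat ?n ?n (\<lambda>(i, j). transpose_mat B $$ (p i, j)))"
    by (simp add: char_poly_def det_transpose[of _ ?n])
  also have "\<dots> = signof p * det (transpose_mat B)"
    by (rule det_permute_rows[OF _ p']) (use B in simp)
  also have "\<dots> = signof p * (signof p * det A)"
    using det_transpose[OF B] det_permute_rows[OF A p'] by (simp add: B_def)
  also have "\<dots> = det A"
    by (simp add: sign_def)
  finally show ?thesis
    by (simp add: char_poly_def A_def)
qed

lemma size_proots_char_poly_symmetric:
  fixes A :: "real mat"
  assumes A: "A \<in> carrier_mat n n" and sym: "transpose_mat A = A"
  shows "size (proots (char_poly A)) = n"
proof -
  define C where "C = map_mat complex_of_real A"
  have C: "C \<in> carrier_mat n n"
    using A by (simp add: C_def)
  have cp: "char_poly C = map_poly complex_of_real (char_poly A)"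
    unfolding C_def by (rule of_real_hom.char_poly_hom[OF A])
  obtain as where as: "char_poly C = (\<Prod>a\<leftarrow>as. [:- a, 1:])" and len: "length as = n"
    using char_poly_factorized[OF C] by blast
  have real_root: "complex_of_real (Re a) = a" if a: "a \<in> set as" for a
  proof -
    have "poly (char_poly C) a = 0"
      using a by (auto simp: as poly_prod_list prod_list_zero_iff)
    then have "eigenvalue C a"
      using eigenvalue_root_char_poly[OF C] by simp
    then obtain v where v: "v \<in> carrier_vec n" "v \<noteq> 0\<^sub>v n" and ev: "C *\<^sub>v v = a \<cdot>\<^sub>v v"
      using C by (auto simp: eigenvalue_def eigenvector_def)
    have conj: "conjugate (C *\<^sub>v v) = C *\<^sub>v conjugate v"
      using A v by (intro eq_vecI) (auto simp: C_def scalar_prod_def)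
    have tC: "transpose_mat C = C"
      using sym by (metis C_def map_mat_transpose)
    have "a * (v \<bullet>c v) = (C *\<^sub>v v) \<bullet>c v"
      using v by (simp add: ev)
    also have "\<dots> = v \<bullet> (C *\<^sub>v conjugate v)"
      using transpose_vec_mult_scalar[OF C, of "conjugate v" v] v by (simp add: tC)
    also have "\<dots> = v \<bullet>c (a \<cdot>\<^sub>v v)"
      by (simp add: conj[symmetric] ev)
    also have "\<dots> = cnj a * (v \<bullet>c v)"
      using v by (simp add: conjugate_smult_vec)
    finally have "a = cnj a"
      using conjugate_square_eq_0_vec[OF v(1)] v(2) by simp
    then show ?thesis
      by (simp add: complex_eq_iff)
  qed
  interpret ofr: map_poly_inj_idom_hom complex_of_real ..
  have "map_poly complex_of_real (\<Prod>a\<leftarrow>as. [:- Re a, 1:])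
      = (\<Prod>a\<leftarrow>as. map_poly complex_of_real [:- Re a, 1:])"
    by (simp add: ofr.hom_prod_list o_def)
  also have "\<dots> = (\<Prod>a\<leftarrow>as. [:- a, 1:])"
    by (rule arg_cong[where f = prod_list], rule map_cong) (simp_all add: real_root)
  finally have "map_poly complex_of_real (char_poly A)
      = map_poly complex_of_real (\<Prod>a\<leftarrow>as. [:- Re a, 1:])"
    by (simp add: cp[symmetric] as)
  then have cpA: "char_poly A = (\<Prod>a\<leftarrow>as. [:- Re a, 1:])"
    by (simp only: ofr.eq_iff)
  have "proots (\<Prod>a\<leftarrow>bs. [:- Re a, 1:]) = mset (map Re bs)" for bs
  proof (induction bs)
    case (Cons b bs)
    have "(\<Prod>a\<leftarrow>bs. [:- Re a, 1:]) \<noteq> 0"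
      by (auto simp: prod_list_zero_iff)
    then have "proots ([:- Re b, 1:] * (\<Prod>a\<leftarrow>bs. [:- Re a, 1:]))
        = proots [:- Re b, 1:] + proots (\<Prod>a\<leftarrow>bs. [:- Re a, 1:])"
      by (intro proots_mult) auto
    then show ?case
      using Cons.IH by simp
  qed simp
  then show ?thesis
    by (simp add: cpA len)
qed

lemma
  assumes "pair_graph G"
  shows adjacency_matrix_obtain:
      "\<exists>vs. distinct vs \<and> set vs = pverts G \<and> adjacency_matrix G = adjacency_matrix_wrt vs G"
    and length_graph_eigenvalues: "length (graph_eigenvalues G) = card (pverts G)"
proof -
  interpret pair_graph G by fact
  have "\<exists>vs. distinct vs \<and> set vs = pverts G"
    using finite_distinct_list[OF pair_finite_verts] by blast
  from someI_ex[OF this]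
  show ex: "\<exists>vs. distinct vs \<and> set vs = pverts G \<and>
      adjacency_matrix G = adjacency_matrix_wrt vs G"
    unfolding adjacency_matrix_def by blast
  then obtain vs where vs: "distinct vs" "set vs = pverts G"
    and M: "adjacency_matrix G = adjacency_matrix_wrt vs G"
    by blast
  have "(x, y) \<in> parcs G \<longleftrightarrow> (y, x) \<in> parcs G" for x y
    using pair_sym_arcs by (auto simp: symmetric_def sym_def)
  then have "transpose_mat (adjacency_matrix G) = adjacency_matrix G"
    unfolding M adjacency_matrix_wrt_def by (intro eq_matI) auto
  moreover have "adjacency_matrix G \<in> carrier_mat (card (pverts G)) (card (pverts G))"
    using vs distinct_card[OF vs(1)] by (simp add: M adjacency_matrix_wrt_def)
  ultimately have "size (proots (char_poly (adjacency_matrix G))) = card (pverts G)"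
    by (intro size_proots_char_poly_symmetric)
  then show "length (graph_eigenvalues G) = card (pverts G)"
    by (simp add: graph_eigenvalues_def flip: size_mset)
qed

lemma graph_eigenvalues_wrt:
  assumes "pair_graph G" "distinct vs" "set vs = pverts G"
  shows "graph_eigenvalues G =
    rev (sorted_list_of_multiset (proots (char_poly (adjacency_matrix_wrt vs G))))"
  using adjacency_matrix_obtain[OF assms(1)] char_poly_adjacency_matrix_wrt assms(2,3)
  unfolding graph_eigenvalues_def by metis

end

theory Submission
  imports Defs "HOL-Analysis.Convex"
begin

text \<open>Let \<open>A\<close> and \<open>B\<close> be the adjacency matrices of \<open>G\<close> and its complement, and let \<open>X\<close> (\<open>Y\<close>) be the
  negative of the part of the spectral decomposition of \<open>A\<close> (\<open>B\<close>) that belongs to the negative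
  ones among the \<open>s\<close> least eigenvalues.
  Their squares add up to \<open>T = \<parallel>X\<parallel>\<^sup>2 + \<parallel>Y\<parallel>\<^sup>2 = - \<langle>A, X\<rangle> - \<langle>B, Y\<rangle>\<close> in the Frobenius inner product, so
  \<open>- 2 T = \<langle>A + B, X + Y\<rangle> + \<langle>A - B, X - Y\<rangle>\<close>. Here \<open>A + B = J - I\<close>, where \<open>J\<close> is the all-ones
  matrix, and \<open>X\<close>, \<open>Y\<close> are positive semidefinite of rank at most \<open>s\<close>, so the first term is at
  least \<open>- tr X - tr Y \<ge> - sqrt (2 s T)\<close>; moreover \<open>\<langle>X, Y\<rangle> \<ge> 0\<close> gives \<open>\<parallel>X - Y\<parallel>\<^sup>2 \<le> T\<close>, and as the entries
  of \<open>A - B\<close> are at most 1 in absolute value, the second term is at least \<open>- n sqrt T\<close>. Hence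
  \<open>sqrt T \<le> n / 2 + sqrt (s / 2)\<close>.
  Nonnegative eigenvalues among the \<open>s\<close> least ones are negligible: since the trace vanishes, they
  increase the sum of squares by a factor of at most \<open>1 + (s / n)\<^sup>2\<close>, which the gap between
  \<open>sqrt (s / 2)\<close> and \<open>s\<close> absorbs.\<close>

subsection \<open>The spectral theorem for real symmetric matrices\<close>

text \<open>\<open>W\<close> is the Householder reflection that exchanges \<open>v\<close> and the first unit vector; the sign of
  \<open>v $ 0\<close> keeps the denominator \<open>1 - v $ 0\<close> away from 0.\<close>

lemma exists_symmetric_involution_col:
  fixes v :: "real vec"
  assumes v: "v \<in> carrier_vec n" and n: "0 < n"
    and norm: "(\<Sum>i<n. (v $ i)\<^sup>2) = 1" and v0: "v $ 0 \<le> 0"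
  shows "\<exists>W \<in> carrier_mat n n. transpose_mat W = W \<and> W * W = 1\<^sub>m n \<and> col W 0 = v"
proof -
  define c where "c = 1 - v $ 0"
  define w where "w i = v $ i - of_bool (i = 0)" for i
  define W where "W = mat n n (\<lambda>(i, j). of_bool (i = j) - w i * w j / c)"
  have c: "c > 0"
    using v0 by (simp add: c_def)
  have "(\<Sum>i<n. (w i)\<^sup>2) = (\<Sum>i<n. (v $ i)\<^sup>2 + (if i = 0 then 1 - 2 * v $ 0 else 0))"
    by (rule sum.cong) (auto simp: w_def power2_eq_square algebra_simps)
  also have "\<dots> = 2 * c"
    using n norm by (simp add: sum.distrib c_def)
  finally have sq: "(\<Sum>i<n. w i * w i) = 2 * c"
    by (simp add: power2_eq_square)
  have W: "W \<in> carrier_mat n n"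
    by (simp add: W_def)
  have "W * W = 1\<^sub>m n"
  proof (rule eq_matI)
    fix i j assume "i < dim_row (1\<^sub>m n :: real mat)" "j < dim_col (1\<^sub>m n :: real mat)"
    then have ij: "i < n" "j < n" by auto
    have "(W * W) $$ (i, j)
        = (\<Sum>k<n. (of_bool (i = k) - w i * w k / c) * (of_bool (k = j) - w k * w j / c))"
      using ij by (simp add: W_def scalar_prod_def atLeast0LessThan)
    also have "\<dots> = (\<Sum>k<n. (if k = i then of_bool (i = j) - w i * w j / c else 0)
        - (if k = j then w i * w j / c else 0) + w i * w j / c\<^sup>2 * (w k * w k))"
      using c by (intro sum.cong) (auto simp: field_simps power2_eq_square)
    also have "\<dots> = of_bool (i = j) - w i * w j / c - w i * w j / c + w i * w j / c\<^sup>2 * (2 * c)"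
      unfolding sum.distrib sum_subtractf sum_distrib_left[symmetric] sq using ij by simp
    also have "\<dots> = (1\<^sub>m n :: real mat) $$ (i, j)"
      using ij c by (simp add: field_simps power2_eq_square)
    finally show "(W * W) $$ (i, j) = (1\<^sub>m n :: real mat) $$ (i, j)" .
  qed (auto simp: W_def)
  moreover have "transpose_mat W = W"
    by (rule eq_matI) (auto simp: W_def mult.commute)
  moreover have "col W 0 = v"
    using n c v by (intro eq_vecI) (auto simp: W_def w_def c_def field_simps)
  ultimately show ?thesis
    using W by blast
qed

text \<open>Eigenvectors may be rescaled: dividing by the norm gives unit length, and the choice of
  sign meets the sign condition of the Householder reflection.\<close>

lemma eigenvalue_unit_eigenvector:
  fixes A :: "real mat"
  assumes A: "A \<in> carrier_mat n n" and e: "eigenvalue A e" and n: "0 < n"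
  shows "\<exists>v \<in> carrier_vec n. A *\<^sub>v v = e \<cdot>\<^sub>v v \<and> (\<Sum>i<n. (v $ i)\<^sup>2) = 1 \<and> v $ 0 \<le> 0"
proof -
  obtain x where x: "x \<in> carrier_vec n" "x \<noteq> 0\<^sub>v n" and ev: "A *\<^sub>v x = e \<cdot>\<^sub>v x"
    using A e by (auto simp: eigenvalue_def eigenvector_def)
  define m where "m = (\<Sum>i<n. (x $ i)\<^sup>2)"
  obtain i where i: "i < n" "x $ i \<noteq> 0"
    using x by (metis carrier_vecD eq_vecI index_zero_vec(1) index_zero_vec(2))
  then have "(x $ i)\<^sup>2 \<le> m"
    unfolding m_def by (intro member_le_sum) auto
  then have m: "m > 0"
    using i by (smt (verit) zero_less_power2)
  define t where "t = (if x $ 0 \<le> 0 then 1 else -1) / sqrt m"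
  have t: "t\<^sup>2 * m = 1"
    using m by (simp add: t_def power_divide)
  have "(\<Sum>i<n. ((t \<cdot>\<^sub>v x) $ i)\<^sup>2) = (\<Sum>i<n. t\<^sup>2 * (x $ i)\<^sup>2)"
    using x by (intro sum.cong) (auto simp: power_mult_distrib)
  also have "\<dots> = 1"
    using t by (simp add: m_def sum_distrib_left)
  finally have "(\<Sum>i<n. ((t \<cdot>\<^sub>v x) $ i)\<^sup>2) = 1" .
  moreover have "(t \<cdot>\<^sub>v x) $ 0 \<le> 0"
    using m x n by (auto simp: t_def divide_le_0_iff)
  moreover have "A *\<^sub>v (t \<cdot>\<^sub>v x) = e \<cdot>\<^sub>v (t \<cdot>\<^sub>v x)"
    using A x ev by (simp add: mult_mat_vec smult_smult_assoc mult.commute)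
  ultimately show ?thesis
    using x by (metis smult_carrier_vec)
qed

text \<open>Deflation: a reflection that exchanges a unit eigenvector for \<open>e\<close> and the
  first unit vector conjugates \<open>A\<close> to a block diagonal matrix with blocks
  \<open>e\<close> and \<open>C\<close>, and induction applies to \<open>C\<close>. The diagonal
  keeps the order of \<open>es\<close>.\<close>

lemma symmetric_spectral_decomposition:
  fixes A :: "real mat"
  assumes "A \<in> carrier_mat n n" "transpose_mat A = A"
    and "char_poly A = (\<Prod>e\<leftarrow>es. [:- e, 1:])"
  shows "\<exists>U. similar_mat_wit A (mat_diag n ((!) es)) U (transpose_mat U)"
  using assms
proof (induction es arbitrary: n A)
  case Nil
  then have "n = 0"
    using degree_monic_char_poly[of A n] by simp
  then have "similar_mat_wit A (mat_diag n ((!) [])) (1\<^sub>m 0) (transpose_mat (1\<^sub>m 0))"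
    using Nil by (intro similar_mat_witI[of _ _ n]) auto
  then show ?case by blast
next
  case (Cons e es)
  note A = Cons.prems(1)
  have "(\<Prod>e\<leftarrow>es. [:- e, 1:]) \<noteq> 0"
    by (auto simp: prod_list_zero_iff)
  then have "degree (char_poly A) = Suc (degree (\<Prod>e\<leftarrow>es. [:- e, 1:]))"
    by (simp add: Cons.prems(3) degree_mult_eq del: mult_pCons_left)
  then obtain m where n: "n = Suc m"
    using degree_monic_char_poly[OF A] by auto
  have "eigenvalue A e"
    unfolding eigenvalue_root_char_poly[OF A] Cons.prems(3) by simp
  then obtain v where v: "v \<in> carrier_vec n" "A *\<^sub>v v = e \<cdot>\<^sub>v v"
    "(\<Sum>i<n. (v $ i)\<^sup>2) = 1" "v $ 0 \<le> 0"
    using eigenvalue_unit_eigenvector[OF A] n by blast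
  then obtain W where W: "W \<in> carrier_mat n n" "transpose_mat W = W" "W * W = 1\<^sub>m n" "col W 0 = v"
    using exists_symmetric_involution_col[of v n] n by blast
  define B where "B = W * A * W"
  have B: "B \<in> carrier_mat n n"
    using A W by (auto simp: B_def)
  have wit: "similar_mat_wit B A W W"
    using A B W by (intro similar_mat_witI[of _ _ n]) (auto simp: B_def)
  have tB: "transpose_mat B = B"
    using A W Cons.prems(2)
    by (simp add: B_def transpose_mult[of _ n n _ n] assoc_mult_mat[of _ n n _ n _ n])
  \<comment> \<open>\<open>col W 0\<close> is the eigenvector \<open>v\<close>, and
    \<open>W * W = 1\<close> means that \<open>W\<close> sends it back to the first unit
    vector.\<close>
  have "col B 0 = W *\<^sub>v (A *\<^sub>v col W 0)"
    unfolding B_def assoc_mult_mat[OF W(1) A W(1)]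
    using A W(1) n by (simp only: col_mult2[of _ n n _ n] mult_carrier_mat zero_less_Suc)
  also have "\<dots> = e \<cdot>\<^sub>v (W *\<^sub>v col W 0)"
    using W v by (simp only: mult_mat_vec[of _ n n])
  also have "W *\<^sub>v col W 0 = col (W * W) 0"
    using n by (intro col_mult2[OF W(1) W(1), symmetric]) simp
  finally have "col B 0 = e \<cdot>\<^sub>v unit_vec n 0"
    using W n by simp
  then have B0: "B $$ (i, 0) = (if i = 0 then e else 0)" if "i < n" for i
    using that B n by (auto simp: vec_eq_iff unit_vec_def)
  then have B0': "B $$ (0, i) = (if i = 0 then e else 0)" if "i < n" for i
    using that tB B n by (metis carrier_matD index_transpose_mat(1) zero_less_Suc)
  define C where "C = mat m m (\<lambda>(i, j). B $$ (Suc i, Suc j))"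
  have C: "C \<in> carrier_mat m m"
    by (simp add: C_def)
  have BC: "B = four_block_mat (mat 1 1 (\<lambda>_. e)) (0\<^sub>m 1 m) (0\<^sub>m m 1) C"
    using B n by (intro eq_matI) (auto simp: C_def B0 B0' four_block_mat_def Let_def)
  have tC: "transpose_mat C = C"
  proof (rule eq_matI)
    fix i j assume "i < dim_row C" "j < dim_col C"
    then have "Suc i < n" "Suc j < n" using C n by auto
    then have "B $$ (Suc i, Suc j) = B $$ (Suc j, Suc i)"
      using tB B by (metis carrier_matD index_transpose_mat(1))
    then show "transpose_mat C $$ (i, j) = C $$ (i, j)"
      using \<open>i < dim_row C\<close> \<open>j < dim_col C\<close> by (simp add: C_def)
  qed (auto simp: C_def)
  have "char_poly (mat 1 1 (\<lambda>_. e)) = [:- e, 1:]"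
    by (subst char_poly_upper_triangular[of _ 1]) (auto simp: diag_mat_def)
  \<comment> \<open>Cancelling the common factor of \<open>e\<close> leaves exactly the roots
    \<open>es\<close> for \<open>C\<close>, as the induction hypothesis requires.\<close>
  then have "[:- e, 1:] * char_poly C = char_poly B"
    unfolding BC by (subst char_poly_four_block_zeros_col[OF _ _ C]) simp_all
  also have "\<dots> = char_poly A"
    using wit by (intro char_poly_similar) (auto simp: similar_mat_def)
  also have "\<dots> = [:- e, 1:] * (\<Prod>e\<leftarrow>es. [:- e, 1:])"
    by (simp add: Cons.prems(3))
  finally have "char_poly C = (\<Prod>e\<leftarrow>es. [:- e, 1:])"
    by (subst (asm) mult_cancel_left) auto
  then obtain U where U: "similar_mat_wit C (mat_diag m ((!) es)) U (transpose_mat U)"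
    using Cons.IH[OF C tC] by blast
  note U' = similar_mat_witD2(6)[OF C U]
  let ?F = "four_block_mat (1\<^sub>m 1) (0\<^sub>m 1 m) (0\<^sub>m m 1) U"
  have tF: "transpose_mat ?F = four_block_mat (1\<^sub>m 1) (0\<^sub>m 1 m) (0\<^sub>m m 1) (transpose_mat U)"
    using U' by (subst transpose_four_block_mat[of _ 1 1 _ m _ m]) auto
  have D: "mat_diag n ((!) (e # es))
      = four_block_mat (mat 1 1 (\<lambda>_. e)) (0\<^sub>m 1 m) (0\<^sub>m m 1) (mat_diag m ((!) es))"
    using n by (intro eq_matI) (auto simp: mat_diag_def four_block_mat_def Let_def nth_Cons')
  have F: "?F \<in> carrier_mat n n"
    using U' n by (metis four_block_carrier_mat one_carrier_mat plus_1_eq_Suc)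
  have "similar_mat_wit B (mat_diag n ((!) (e # es))) ?F (transpose_mat ?F)"
    unfolding tF D unfolding BC using U' C
    by (intro similar_mat_wit_four_block[OF similar_mat_wit_refl[of _ 1] U]) auto
  then have "similar_mat_wit A (mat_diag n ((!) (e # es))) (W * ?F) (transpose_mat ?F * W)"
    using similar_mat_wit_trans[OF similar_mat_wit_sym[OF wit]] by blast
  moreover have "transpose_mat ?F * W = transpose_mat (W * ?F)"
    using W F by (simp add: transpose_mult[of _ n n _ n])
  ultimately show ?case by auto
qed

text \<open>Splitting off a root leaves a monic quotient whose degree and number of roots both drop
  by one.\<close>

lemma prod_linear_factors_proots:
  fixes p :: "'a :: idom poly"
  assumes "size (proots p) = degree p" "monic p"
  shows "p = (\<Prod>a\<in>#proots p. [:- a, 1:])"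
  using assms
proof (induction "degree p" arbitrary: p)
  case 0
  then show ?case
    by (metis monic_degree_0 proots_1 image_mset_empty prod_mset_empty)
next
  case (Suc d)
  then obtain a where a: "a \<in># proots p"
    by (metis multiset_nonemptyE size_empty nat.distinct(1))
  have p: "p \<noteq> 0"
    using Suc by auto
  then obtain q where q: "p = [:- a, 1:] * q"
    using a by (auto simp: poly_eq_0_iff_dvd)
  have q0: "q \<noteq> 0"
    using p q by auto
  have pq: "proots p = {#a#} + proots q"
    unfolding q using q0 by (subst proots_mult) auto
  have dq: "degree p = Suc (degree q)"
    unfolding q using q0 by (subst degree_mult_eq) auto
  moreover have "monic q"
    using Suc.prems(2) unfolding q lead_coeff_mult by simp
  ultimately have "q = (\<Prod>a\<in>#proots q. [:- a, 1:])"
    using Suc pq by (intro Suc.hyps(1)) auto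
  then show ?case
    unfolding pq using q by simp
qed

text \<open>\<open>U\<close> is inverted by its transpose, so its columns are orthonormal and
  \<open>A = U D U^T\<close> becomes \<open>A U = U D\<close>. The trace follows by summing over the
  columns, which have unit length.\<close>

lemma spectral_decompositionD:
  fixes A U :: "real mat"
  assumes A: "A \<in> carrier_mat n n"
    and wit: "similar_mat_wit A (mat_diag n e) U (transpose_mat U)"
  shows "\<And>k l. k < n \<Longrightarrow> l < n \<Longrightarrow> (\<Sum>i<n. U $$ (i, k) * U $$ (i, l)) = of_bool (k = l)"
    and "\<And>i k. i < n \<Longrightarrow> k < n \<Longrightarrow> (\<Sum>j<n. A $$ (i, j) * U $$ (j, k)) = e k * U $$ (i, k)"
    and "(\<Sum>i<n. A $$ (i, i)) = (\<Sum>k<n. e k)"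
proof -
  note W = similar_mat_witD2[OF A wit]
  show orth: "(\<Sum>i<n. U $$ (i, k) * U $$ (i, l)) = of_bool (k = l)" if "k < n" "l < n" for k l
    using arg_cong[OF W(2), of "\<lambda>M. M $$ (k, l)"] W(6) that
    by (simp add: scalar_prod_def atLeast0LessThan)
  have "A * U = U * mat_diag n e * (transpose_mat U * U)"
    by (subst W(3)) (use W(5-7) in \<open>simp add: assoc_mult_mat[of "U * mat_diag n e" n n _ n _ n]\<close>)
  then have AU: "A * U = U * mat_diag n e"
    using W(2,5,6) by simp
  show "(\<Sum>j<n. A $$ (i, j) * U $$ (j, k)) = e k * U $$ (i, k)" if "i < n" "k < n" for i k
    using arg_cong[OF AU, of "\<lambda>M. M $$ (i, k)"] A W(6) that
    by (simp add: mat_diag_mult_right[of _ n] scalar_prod_def atLeast0LessThan mult.commute)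
  have "A $$ (i, i) = (\<Sum>k<n. e k * (U $$ (i, k) * U $$ (i, k)))" if "i < n" for i
    by (subst W(3)) (use that W(6) in
      \<open>simp add: mat_diag_mult_right[of _ n] scalar_prod_def atLeast0LessThan mult_ac\<close>)
  then have "(\<Sum>i<n. A $$ (i, i)) = (\<Sum>i<n. \<Sum>k<n. e k * (U $$ (i, k) * U $$ (i, k)))"
    by simp
  also have "\<dots> = (\<Sum>k<n. e k * (\<Sum>i<n. U $$ (i, k) * U $$ (i, k)))"
    by (subst sum.swap) (simp add: sum_distrib_left)
  also have "\<dots> = (\<Sum>k<n. e k)"
    by (simp add: orth)
  finally show "(\<Sum>i<n. A $$ (i, i)) = (\<Sum>k<n. e k)" .
qed

subsection \<open>The Frobenius inner product\<close>

definition frobenius :: "nat \<Rightarrow> (nat \<Rightarrow> nat \<Rightarrow> real) \<Rightarrow> (nat \<Rightarrow> nat \<Rightarrow> real) \<Rightarrow> real" where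
  "frobenius n M N = (\<Sum>i<n. \<Sum>j<n. M i j * N i j)"

text \<open>This is the matrix with terms \<open>a k\<close> times \<open>u_k u_k^T\<close>; with
  orthonormal eigenvectors and eigenvalues as weights it is a part of a spectral
  decomposition.\<close>

definition rank_one_sum ::
    "nat set \<Rightarrow> (nat \<Rightarrow> real) \<Rightarrow> (nat \<Rightarrow> nat \<Rightarrow> real) \<Rightarrow> nat \<Rightarrow> nat \<Rightarrow> real" where
  "rank_one_sum K a u i j = (\<Sum>k\<in>K. a k * (u k i * u k j))"

lemma frobenius_commute: "frobenius n M N = frobenius n N M"
  by (simp add: frobenius_def mult.commute)

lemma frobenius_Cauchy_Schwarz:
  "(frobenius n M N)\<^sup>2 \<le> frobenius n M M * frobenius n N N"
  using Cauchy_Schwarz_ineq_sum[of "\<lambda>(i, j). M i j" "\<lambda>(i, j). N i j" "{..<n} \<times> {..<n}"]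
  by (simp add: frobenius_def sum.cartesian_product case_prod_unfold power2_eq_square)

lemma frobenius_rank_one_sum:
  "frobenius n M (rank_one_sum K a u)
    = (\<Sum>k\<in>K. a k * (\<Sum>i<n. \<Sum>j<n. M i j * (u k i * u k j)))"
proof -
  have "frobenius n M (rank_one_sum K a u)
      = (\<Sum>i<n. \<Sum>j<n. \<Sum>k\<in>K. a k * (M i j * (u k i * u k j)))"
    by (simp add: frobenius_def rank_one_sum_def sum_distrib_left mult_ac)
  also have "\<dots> = (\<Sum>i<n. \<Sum>k\<in>K. \<Sum>j<n. a k * (M i j * (u k i * u k j)))"
    by (subst (2) sum.swap) simp
  also have "\<dots> = (\<Sum>k\<in>K. \<Sum>i<n. \<Sum>j<n. a k * (M i j * (u k i * u k j)))"
    by (rule sum.swap)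
  finally show ?thesis
    by (simp add: sum_distrib_left)
qed

text \<open>Used for the positive semidefiniteness of the all-ones matrix: nonnegative weights give
  a nonnegative value.\<close>

lemma frobenius_ones_rank_one_sum:
  "frobenius n (\<lambda>i j. 1) (rank_one_sum K a u) = (\<Sum>k\<in>K. a k * (\<Sum>i<n. u k i)\<^sup>2)"
  by (simp add: frobenius_rank_one_sum power2_eq_square sum_product)

text \<open>The pairing with the identity is the trace.\<close>

lemma frobenius_id_rank_one_sum:
  "frobenius n (\<lambda>i j. of_bool (i = j)) (rank_one_sum K a u) = (\<Sum>k\<in>K. a k * (\<Sum>i<n. (u k i)\<^sup>2))"
  by (simp add: frobenius_rank_one_sum power2_eq_square of_bool_def if_distrib[of "\<lambda>c. c * _"]
      cong: if_cong)

text \<open>Source of \<open>\<langle>X, Y\<rangle> \<ge> 0\<close>: with nonnegative weights every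
  term is nonnegative.\<close>

lemma frobenius_rank_one_sums:
  "frobenius n (rank_one_sum L b w) (rank_one_sum K a u)
    = (\<Sum>k\<in>K. \<Sum>l\<in>L. a k * b l * (\<Sum>i<n. u k i * w l i)\<^sup>2)"
proof -
  \<comment> \<open>A quadratic form is a pairing with the matrix \<open>x i * x j\<close>, so the
    formula for a single rank-one sum applies a second time.\<close>
  have "(\<Sum>i<n. \<Sum>j<n. rank_one_sum L b w i j * (x i * x j))
      = (\<Sum>l\<in>L. b l * (\<Sum>i<n. x i * w l i)\<^sup>2)" for x :: "nat \<Rightarrow> real"
    using frobenius_rank_one_sum[of n "\<lambda>i j. x i * x j" L b w]
    by (simp add: frobenius_def power2_eq_square sum_product mult_ac)
  then show ?thesis
    by (simp add: frobenius_rank_one_sum sum_distrib_left mult_ac)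
qed

lemma frobenius_linear:
  "frobenius n (\<lambda>i j. M i j + M' i j) N = frobenius n M N + frobenius n M' N"
  "frobenius n (\<lambda>i j. M i j - M' i j) N = frobenius n M N - frobenius n M' N"
  by (simp_all add: frobenius_def algebra_simps sum.distrib sum_subtractf)

lemma frobenius_linear_right:
  "frobenius n N (\<lambda>i j. M i j + M' i j) = frobenius n N M + frobenius n N M'"
  "frobenius n N (\<lambda>i j. M i j - M' i j) = frobenius n N M - frobenius n N M'"
  by (simp_all add: frobenius_def algebra_simps sum.distrib sum_subtractf)

text \<open>The first index of \<open>u\<close> numbers the eigenvectors and the second their
  coordinates, the reverse of eigenvectors stored as matrix columns.\<close>

locale eigenbasis =
  fixes n :: nat and A :: "nat \<Rightarrow> nat \<Rightarrow> real" and e :: "nat \<Rightarrow> real"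
    and u :: "nat \<Rightarrow> nat \<Rightarrow> real"
  assumes orthonormal: "k < n \<Longrightarrow> l < n \<Longrightarrow> (\<Sum>i<n. u k i * u l i) = of_bool (k = l)"
    and eigen: "i < n \<Longrightarrow> k < n \<Longrightarrow> (\<Sum>j<n. A i j * u k j) = e k * u k i"
begin

lemma unit: "k < n \<Longrightarrow> (\<Sum>i<n. (u k i)\<^sup>2) = 1"
  using orthonormal[of k k] by (simp add: power2_eq_square)

lemma frobenius_spectral_part:
  assumes "K \<subseteq> {..<n}"
  shows "frobenius n A (rank_one_sum K a u) = (\<Sum>k\<in>K. a k * e k)"
  unfolding frobenius_rank_one_sum
proof (rule sum.cong)
  fix k assume "k \<in> K"
  then have k: "k < n" using assms by auto
  have "(\<Sum>i<n. \<Sum>j<n. A i j * (u k i * u k j)) = (\<Sum>i<n. u k i * (\<Sum>j<n. A i j * u k j))"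
    by (simp add: sum_distrib_left mult_ac)
  also have "\<dots> = (\<Sum>i<n. e k * (u k i)\<^sup>2)"
    using k by (intro sum.cong) (auto simp: eigen power2_eq_square)
  also have "\<dots> = e k"
    using unit[OF k] by (simp flip: sum_distrib_left)
  finally show "a k * (\<Sum>i<n. \<Sum>j<n. A i j * (u k i * u k j)) = a k * e k" by simp
qed simp

lemma frobenius_self:
  assumes "K \<subseteq> {..<n}"
  shows "frobenius n (rank_one_sum K a u) (rank_one_sum K a u) = (\<Sum>k\<in>K. (a k)\<^sup>2)"
proof -
  have fin: "finite K"
    using assms finite_subset by blast
  have "(\<Sum>l\<in>K. a k * a l * (\<Sum>i<n. u k i * u l i)\<^sup>2) = (a k)\<^sup>2" if k: "k \<in> K" for k
  proof -
    have "(\<Sum>l\<in>K. a k * a l * (\<Sum>i<n. u k i * u l i)\<^sup>2) = (\<Sum>l\<in>K. if l = k then (a k)\<^sup>2 else 0)"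
      using assms k by (intro sum.cong) (auto simp: orthonormal power2_eq_square subset_iff)
    then show ?thesis
      using fin k by simp
  qed
  then show ?thesis
    by (simp add: frobenius_rank_one_sums)
qed

end

section \<open>The bound for the negative eigenvalues\<close>

text \<open>The signs on \<open>K\<close> and \<open>L\<close> make \<open>X\<close> and
  \<open>Y\<close> positive semidefinite; the cardinalities enter through Cauchy-Schwarz for the
  traces.\<close>

lemma complementary_negative_energy_bound:
  fixes A B :: "nat \<Rightarrow> nat \<Rightarrow> real"
  assumes A: "eigenbasis n A e u" and B: "eigenbasis n B f w"
    and K: "K \<subseteq> {..<n}" "\<And>k. k \<in> K \<Longrightarrow> e k \<le> 0" "card K \<le> s"
    and L: "L \<subseteq> {..<n}" "\<And>k. k \<in> L \<Longrightarrow> f k \<le> 0" "card L \<le> s"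
    and sum: "\<And>i j. i < n \<Longrightarrow> j < n \<Longrightarrow> A i j + B i j = 1 - of_bool (i = j)"
    and diff: "\<And>i j. i < n \<Longrightarrow> j < n \<Longrightarrow> \<bar>A i j - B i j\<bar> \<le> 1"
  shows "(\<Sum>k\<in>K. (e k)\<^sup>2) + (\<Sum>k\<in>L. (f k)\<^sup>2) \<le> (real n / 2 + sqrt (real s / 2))\<^sup>2"
proof -
  interpret A: eigenbasis n A e u by fact
  interpret B: eigenbasis n B f w by fact
  define X where "X = rank_one_sum K (\<lambda>k. - e k) u"
  define Y where "Y = rank_one_sum L (\<lambda>k. - f k) w"
  define T where "T = (\<Sum>k\<in>K. (e k)\<^sup>2) + (\<Sum>k\<in>L. (f k)\<^sup>2)"
  \<comment> \<open>\<open>N\<close> is \<open>tr X + tr Y\<close>, the eigenvectors having unit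
    length.\<close>
  define N where "N = (\<Sum>k\<in>K. - e k) + (\<Sum>k\<in>L. - f k)"
  have fin: "finite K" "finite L"
    using K L finite_subset by blast+
  have T0: "T \<ge> 0"
    unfolding T_def by (intro add_nonneg_nonneg sum_nonneg) auto
  have AX: "frobenius n A X + frobenius n B Y = - T"
    using A.frobenius_spectral_part[OF K(1)] B.frobenius_spectral_part[OF L(1)]
    by (simp add: X_def Y_def T_def power2_eq_square sum_negf)
  have "(\<Sum>k\<in>K. - e k * (\<Sum>i<n. (u k i)\<^sup>2)) = (\<Sum>k\<in>K. - e k)"
    "(\<Sum>k\<in>L. - f k * (\<Sum>i<n. (w k i)\<^sup>2)) = (\<Sum>k\<in>L. - f k)"
    using K(1) L(1) by (auto intro!: sum.cong simp: A.unit B.unit subset_iff)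
  then have tr: "frobenius n (\<lambda>i j. of_bool (i = j)) X + frobenius n (\<lambda>i j. of_bool (i = j)) Y = N"
    by (simp only: X_def Y_def N_def frobenius_id_rank_one_sum)
  have ones: "frobenius n (\<lambda>i j. 1) X \<ge> 0" "frobenius n (\<lambda>i j. 1) Y \<ge> 0"
    using K(2) L(2)
    by (auto simp: X_def Y_def frobenius_ones_rank_one_sum intro!: sum_nonneg mult_nonneg_nonneg
        simp del: mult_minus_left)
  have AB: "frobenius n (\<lambda>i j. A i j + B i j) M
      = frobenius n (\<lambda>i j. 1) M - frobenius n (\<lambda>i j. of_bool (i = j)) M" for M
    unfolding frobenius_linear(2)[symmetric] unfolding frobenius_def
    by (intro sum.cong) (auto simp: sum)
  \<comment> \<open>The all-ones part contributes a nonnegative amount and is dropped; the identity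
    contributes \<open>- N\<close>.\<close>
  have plus: "frobenius n (\<lambda>i j. A i j + B i j) (\<lambda>i j. X i j + Y i j) \<ge> - N"
    using tr ones by (simp add: frobenius_linear_right AB)
  have "frobenius n X Y \<ge> 0"
    using K(2) L(2)
    unfolding X_def Y_def frobenius_rank_one_sums
    by (intro sum_nonneg mult_nonneg_nonneg zero_le_power2) auto
  moreover have "frobenius n X X + frobenius n Y Y = T"
    using A.frobenius_self[OF K(1)] B.frobenius_self[OF L(1)] by (simp add: X_def Y_def T_def)
  ultimately have XY: "frobenius n (\<lambda>i j. X i j - Y i j) (\<lambda>i j. X i j - Y i j) \<le> T"
    using frobenius_commute[of n X Y] by (simp add: frobenius_linear frobenius_linear_right)
  have "(A i j - B i j) * (A i j - B i j) \<le> 1" if "i < n" "j < n" for i j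
    using diff[OF that] abs_square_le_1 by (auto simp: power2_eq_square)
  then have "frobenius n (\<lambda>i j. A i j - B i j) (\<lambda>i j. A i j - B i j) \<le> (\<Sum>i<n. \<Sum>j<n. 1)"
    unfolding frobenius_def by (intro sum_mono) auto
  then have AB2: "frobenius n (\<lambda>i j. A i j - B i j) (\<lambda>i j. A i j - B i j) \<le> (real n)\<^sup>2"
    by (simp add: power2_eq_square)
  have "(frobenius n (\<lambda>i j. A i j - B i j) (\<lambda>i j. X i j - Y i j))\<^sup>2 \<le> (real n)\<^sup>2 * T"
    using frobenius_Cauchy_Schwarz AB2 XY
    by (rule order_trans[OF _ mult_mono]) (auto simp: frobenius_def intro!: sum_nonneg)
  also have "\<dots> = (real n * sqrt T)\<^sup>2"
    using T0 by (simp add: power_mult_distrib)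
  finally have minus: "frobenius n (\<lambda>i j. A i j - B i j) (\<lambda>i j. X i j - Y i j) \<ge> - (real n * sqrt T)"
    using T0 abs_le_square_iff[of "frobenius n (\<lambda>i j. A i j - B i j) (\<lambda>i j. X i j - Y i j)"
        "real n * sqrt T"] by (simp add: abs_le_iff)
  \<comment> \<open>Polarisation: the pairings in \<open>plus\<close> and \<open>minus\<close> add
    up to twice the sum in \<open>AX\<close>, that is to \<open>- 2 * T\<close>.\<close>
  have "2 * T \<le> N + real n * sqrt T"
    using plus minus AX by (simp add: frobenius_linear frobenius_linear_right)
  moreover have "N \<le> sqrt (2 * s) * sqrt T"
  proof -
    \<comment> \<open>The factor 2 comes from merging two traces, the factor \<open>s\<close> below
      from Cauchy-Schwarz against the constant 1 on at most \<open>s\<close> indices.\<close>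
    have "N\<^sup>2 \<le> 2 * ((\<Sum>k\<in>K. - e k)\<^sup>2 + (\<Sum>k\<in>L. - f k)\<^sup>2)"
      unfolding N_def using sum_squares_bound[of "\<Sum>k\<in>K. - e k" "\<Sum>k\<in>L. - f k"]
      by (simp add: power2_sum)
    also have "\<dots> \<le> 2 * (real s * (\<Sum>k\<in>K. (e k)\<^sup>2) + real s * (\<Sum>k\<in>L. (f k)\<^sup>2))"
    proof (intro mult_left_mono add_mono)
      have "(\<Sum>k\<in>M. - g k)\<^sup>2 \<le> real s * (\<Sum>k\<in>M. (g k)\<^sup>2)" if "card M \<le> s"
        for M :: "nat set" and g :: "nat \<Rightarrow> real"
        using Cauchy_Schwarz_ineq_sum[of "\<lambda>_. 1" "\<lambda>k. - g k" M]
          mult_right_mono[of "real (card M)" "real s" "\<Sum>k\<in>M. (g k)\<^sup>2"] that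
        by (simp add: sum_nonneg)
      then show "(\<Sum>k\<in>K. - e k)\<^sup>2 \<le> real s * (\<Sum>k\<in>K. (e k)\<^sup>2)"
        "(\<Sum>k\<in>L. - f k)\<^sup>2 \<le> real s * (\<Sum>k\<in>L. (f k)\<^sup>2)"
        using K(3) L(3) by blast+
    qed simp
    also have "\<dots> = 2 * s * T"
      by (simp add: T_def algebra_simps)
    finally have "N \<le> sqrt (2 * s * T)"
      by (rule real_le_rsqrt)
    then show ?thesis
      by (simp add: real_sqrt_mult)
  qed
  moreover have "2 * sqrt T * sqrt T = 2 * T"
    using T0 by simp
  ultimately have "2 * sqrt T * sqrt T \<le> (sqrt (2 * s) + real n) * sqrt T"
    unfolding distrib_right by linarith
  \<comment> \<open>Dividing by \<open>sqrt T\<close> excludes \<open>T = 0\<close>, where the final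
    bound is trivial.\<close>
  then have "2 * sqrt T \<le> sqrt (2 * s) + real n \<or> T = 0"
    using T0 by (auto simp: mult_le_cancel_right)
  moreover have "sqrt (2 * s) = 2 * sqrt (s / 2)"
    by (rule real_sqrt_unique) (auto simp: power_mult_distrib)
  ultimately have "sqrt T \<le> real n / 2 + sqrt (s / 2)"
    by auto
  then show ?thesis
    unfolding T_def[symmetric] by (metis T0 real_sqrt_ge_0_iff real_sqrt_pow2 power_mono)
qed

section \<open>Nonnegative eigenvalues among the least ones\<close>

text \<open>If the largest of the first \<open>s\<close> entries, \<open>t\<close>, is nonnegative,
  then the \<open>n - s\<close> later ones are at least \<open>t\<close>. As the total is 0, the
  negative entries must outweigh \<open>(n - s) * t\<close>, so \<open>t\<close> is small compared
  with them.\<close>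

lemma sorted_sum_zero_bottom_squares:
  fixes xs :: "real list"
  assumes sorted: "sorted xs" and n: "length xs = n" "2 * s \<le> n"
    and zero: "(\<Sum>k<n. xs ! k) = 0"
  shows "(\<Sum>k<s. (xs ! k)\<^sup>2)
    \<le> (1 + (real s / real n)\<^sup>2) * (\<Sum>k | k < s \<and> xs ! k < 0. (xs ! k)\<^sup>2)"
proof -
  define K where "K = {k. k < s \<and> xs ! k < 0}"
  define P where "P = {k. k < s \<and> xs ! k \<ge> 0}"
  define Q where "Q = (\<Sum>k\<in>K. (xs ! k)\<^sup>2)"
  have fin: "finite K" "finite P"
    by (auto simp: K_def P_def)
  have KP: "{..<s} = K \<union> P" "K \<inter> P = {}"
    by (auto simp: K_def P_def)
  have Q0: "Q \<ge> 0"
    by (auto simp: Q_def intro: sum_nonneg)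
  have "(\<Sum>k\<in>P. (xs ! k)\<^sup>2) \<le> (real s / real n)\<^sup>2 * Q"
  proof (cases "P = {}")
    case False
    define t where "t = xs ! (s - 1)"
    have s: "s > 0" "s < n"
      using False n by (auto simp: P_def)
    have t0: "t \<ge> 0"
    proof -
      obtain k where k: "k < s" "xs ! k \<ge> 0"
        using False by (auto simp: P_def)
      then have "xs ! k \<le> t"
        unfolding t_def using s n by (intro sorted_nth_mono[OF sorted]) auto
      then show ?thesis
        using k by simp
    qed
    have "(\<Sum>k\<in>P. (xs ! k)\<^sup>2) \<le> (\<Sum>k\<in>P. t\<^sup>2)"
      unfolding t_def using s n sorted_nth_mono[OF sorted]
      by (intro sum_mono power_mono) (auto simp: P_def)
    then have P: "(\<Sum>k\<in>P. (xs ! k)\<^sup>2) \<le> card P * t\<^sup>2"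
      by simp
    have "real (n - s) * t = (\<Sum>k=s..<n. t)"
      by simp
    also have "\<dots> \<le> (\<Sum>k=s..<n. xs ! k)"
      unfolding t_def using n by (intro sum_mono sorted_nth_mono[OF sorted]) auto
    also have "\<dots> = - (\<Sum>k<s. xs ! k)"
      using zero sum.atLeastLessThan_concat[of 0 s n "(!) xs"] s by (simp add: atLeast0LessThan)
    also have "\<dots> \<le> - (\<Sum>k\<in>K. xs ! k)"
      unfolding KP(1) using fin KP(2)
      by (subst sum.union_disjoint) (auto simp: P_def intro!: sum_nonneg)
    finally have "(real (n - s) * t)\<^sup>2 \<le> (- (\<Sum>k\<in>K. xs ! k))\<^sup>2"
      using t0 by (intro power_mono) auto
    also have "\<dots> \<le> card K * Q"
      using Cauchy_Schwarz_ineq_sum[of "\<lambda>_. 1" "(!) xs" K] by (simp add: Q_def)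
    finally have t: "(real (n - s))\<^sup>2 * t\<^sup>2 \<le> card K * Q"
      by (simp add: power_mult_distrib)
    have "card K + card P = s"
      using card_Un_disjoint[OF fin KP(2)] unfolding KP(1)[symmetric] by simp
    then have s_eq: "real s = real (card P) + real (card K)"
      by linarith
    \<comment> \<open>AM-GM for two cardinalities with sum \<open>s\<close>.\<close>
    have PK: "4 * (real (card P) * real (card K)) \<le> (real s)\<^sup>2"
      unfolding s_eq using sum_squares_bound[of "real (card P)" "real (card K)"]
      by (simp add: power2_sum mult_ac)
    \<comment> \<open>\<open>2 * s \<le> n\<close> gives \<open>n \<le> 2 * (n - s)\<close>; the
      resulting factor 4 is absorbed by \<open>PK\<close>.\<close>
    have "(real n)\<^sup>2 * (\<Sum>k\<in>P. (xs ! k)\<^sup>2) \<le> (2 * real (n - s))\<^sup>2 * (card P * t\<^sup>2)"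
      using P n by (intro mult_mono power_mono) (auto simp: sum_nonneg)
    also have "\<dots> = 4 * (card P * ((real (n - s))\<^sup>2 * t\<^sup>2))"
      by (simp add: power_mult_distrib)
    also have "\<dots> \<le> 4 * (card P * (card K * Q))"
      using t by (intro mult_left_mono) auto
    also have "\<dots> \<le> (real s)\<^sup>2 * Q"
      using mult_right_mono[OF PK Q0] by (simp add: mult_ac)
    finally show ?thesis
      using s by (simp add: power_divide field_simps)
  qed (use Q0 in simp)
  then show ?thesis
    unfolding KP(1) K_def[symmetric] Q_def[symmetric] using fin KP(2)
    by (subst sum.union_disjoint) (auto simp: Q_def algebra_simps)
qed

text \<open>Since \<open>sqrt (s / 2) \<le> 5 / 7 * s\<close> and \<open>s / n < 1 / 2\<close>, it
  suffices that \<open>2 / 7 * (n * s)\<close> exceeds \<open>12 / 49 * (s * s)\<close>, which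
  \<open>n > 2 * s\<close> ensures.\<close>

lemma bottom_squares_numeric_bound:
  fixes n s :: real
  assumes "s \<ge> 1" "n > 2 * s"
  shows "(1 + (s / n)\<^sup>2) * (n / 2 + sqrt (s / 2))\<^sup>2 \<le> (n / 2 + s)\<^sup>2"
proof -
  define c where "c = sqrt (s / 2)"
  have "s * 1 \<le> s * s"
    using assms by (intro mult_left_mono) auto
  \<comment> \<open>5/7 is a rational upper bound for 1/sqrt 2, as 25/49 > 1/2;
    \<open>s \<ge> 1\<close> replaces \<open>s\<close> by its square under the root.\<close>
  then have c: "c \<le> 5 / 7 * s"
    unfolding c_def using assms by (intro real_le_lsqrt) (auto simp: power2_eq_square)
  have c0: "c \<ge> 0"
    using assms by (simp add: c_def)
  \<comment> \<open>6/7 is 1/2 + 1/2 * 5/7.\<close>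
  have r: "s / n * (n / 2 + c) \<le> 6 / 7 * s"
  proof -
    have "s / n * (n / 2 + c) = s / 2 + s / n * c"
      using assms by (simp add: field_simps)
    also have "s / n * c \<le> 1 / 2 * (5 / 7 * s)"
      using assms c c0 by (intro mult_mono) (auto simp: field_simps)
    finally show ?thesis
      by simp
  qed
  have "(1 + (s / n)\<^sup>2) * (n / 2 + c)\<^sup>2 = (n / 2 + c)\<^sup>2 + (s / n * (n / 2 + c))\<^sup>2"
    by (simp only: distrib_right mult_1 power_mult_distrib)
  also have "\<dots> \<le> (n / 2 + 5 / 7 * s)\<^sup>2 + (6 / 7 * s)\<^sup>2"
    using assms c c0 r by (intro add_mono power_mono) auto
  also have "\<dots> \<le> (n / 2 + s)\<^sup>2"
  proof -
    have "2 * s * s \<le> n * s"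
      using assms by (intro mult_right_mono) auto
    moreover have "(n / 2 + s)\<^sup>2 - ((n / 2 + 5 / 7 * s)\<^sup>2 + (6 / 7 * s)\<^sup>2)
        = 2 / 7 * (n * s) - 12 / 49 * (s * s)"
      by (simp add: power2_eq_square field_simps)
    moreover have "s * s \<ge> 0"
      by simp
    ultimately show ?thesis
      by linarith
  qed
  finally show ?thesis
    by (simp add: c_def)
qed

subsection \<open>Graphs\<close>

text \<open>The vertex list is a parameter so that a graph and its complement can share one
  indexing. Reversal puts the least eigenvalues first.\<close>

lemma graph_eigenbasis:
  assumes H: "pair_graph H" and vs: "distinct vs" "set vs = pverts H"
  defines "es \<equiv> rev (graph_eigenvalues H)"
  shows "sorted es" "length es = length vs" "(\<Sum>k<length vs. es ! k) = 0"
    and "\<exists>u. eigenbasis (length vs) (\<lambda>i j. of_bool ((vs ! i, vs ! j) \<in> parcs H)) ((!) es) u"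
proof -
  interpret pair_graph H by fact
  let ?n = "length vs"
  let ?A = "adjacency_matrix_wrt vs H"
  have A: "?A \<in> carrier_mat ?n ?n"
    by (simp add: adjacency_matrix_wrt_def)
  have "(x, y) \<in> parcs H \<longleftrightarrow> (y, x) \<in> parcs H" for x y
    using pair_sym_arcs by (auto simp: symmetric_def sym_def)
  then have sym: "transpose_mat ?A = ?A"
    unfolding adjacency_matrix_wrt_def by (intro eq_matI) auto
  have es: "es = sorted_list_of_multiset (proots (char_poly ?A))"
    using graph_eigenvalues_wrt[OF H vs] by (simp add: es_def)
  then show "sorted es"
    by simp
  show "length es = ?n"
    unfolding es_def
    by (simp add: length_graph_eigenvalues[OF H] vs(2)[symmetric] distinct_card[OF vs(1)])
  \<comment> \<open>By symmetry the number of real roots equals the degree, so the polynomial splits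
    over the reals.\<close>
  have "char_poly ?A = (\<Prod>a\<in>#proots (char_poly ?A). [:- a, 1:])"
    using size_proots_char_poly_symmetric[OF A sym] degree_monic_char_poly[OF A]
    by (intro prod_linear_factors_proots) auto
  also have "\<dots> = (\<Prod>e\<leftarrow>es. [:- e, 1:])"
    by (simp add: es flip: prod_mset_prod_list)
  finally obtain U where U: "similar_mat_wit ?A (mat_diag ?n ((!) es)) U (transpose_mat U)"
    using symmetric_spectral_decomposition[OF A sym] by blast
  note D = spectral_decompositionD[OF A U]
  \<comment> \<open>Without loops the diagonal vanishes, and the trace is the sum of the
    eigenvalues.\<close>
  have "(x, x) \<notin> parcs H" for x
    using pair_no_loops[of "(x, x)"] by auto
  then show "(\<Sum>k<?n. es ! k) = 0"
    using D(3) by (simp add: adjacency_matrix_wrt_def)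
  have "eigenbasis ?n (\<lambda>i j. of_bool ((vs ! i, vs ! j) \<in> parcs H)) ((!) es) (\<lambda>k i. U $$ (i, k))"
  proof
    fix i k assume ik: "i < ?n" "k < ?n"
    have "(\<Sum>j<?n. of_bool ((vs ! i, vs ! j) \<in> parcs H) * U $$ (j, k))
        = (\<Sum>j<?n. ?A $$ (i, j) * U $$ (j, k))"
      using ik by (intro sum.cong) (auto simp: adjacency_matrix_wrt_def)
    then show "(\<Sum>j<?n. of_bool ((vs ! i, vs ! j) \<in> parcs H) * U $$ (j, k)) = es ! k * U $$ (i, k)"
      using D(2)[OF ik] by simp
  qed (use D(1) in auto)
  then show "\<exists>u. eigenbasis ?n (\<lambda>i j. of_bool ((vs ! i, vs ! j) \<in> parcs H)) ((!) es) u"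
    by blast
qed

theorem theorem5:
  fixes G :: "'a pair_pre_digraph" and n s :: nat
  assumes "pair_graph G"
    and "card (pverts G) = n"
    and "s \<ge> 1"
    and "n > 2 * s"
  shows "(\<Sum>i = 1..s. (graph_eigenvalue G (n - i + 1))\<^sup>2
            + (graph_eigenvalue (complement_graph G) (n - i + 1))\<^sup>2)
          \<le> (real n / 2 + real s)\<^sup>2"
proof -
  let ?H = "complement_graph G"
  obtain vs where vs: "distinct vs" "set vs = pverts G"
    using adjacency_matrix_obtain[OF assms(1)] by blast
  then have vs': "set vs = pverts ?H"
    by (simp add: complement_graph_def)
  have len: "length vs = n"
    using vs assms(2) distinct_card by metis
  define es where "es = rev (graph_eigenvalues G)"
  define fs where "fs = rev (graph_eigenvalues ?H)"
  note E = graph_eigenbasis[OF assms(1) vs, folded es_def, unfolded len]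
  note F = graph_eigenbasis[OF pair_graph_complement_graph[OF assms(1)] vs(1) vs',
      folded fs_def, unfolded len]
  obtain u w
    where u: "eigenbasis n (\<lambda>i j. of_bool ((vs ! i, vs ! j) \<in> parcs G)) ((!) es) u"
      and w: "eigenbasis n (\<lambda>i j. of_bool ((vs ! i, vs ! j) \<in> parcs ?H)) ((!) fs) w"
    using E(4) F(4) by blast
  define K where "K = {k. k < s \<and> es ! k < 0}"
  define L where "L = {k. k < s \<and> fs ! k < 0}"
  have "K \<subseteq> {..<s}" "L \<subseteq> {..<s}"
    by (auto simp: K_def L_def)
  then have card: "card K \<le> s" "card L \<le> s"
    by (metis card_lessThan card_mono finite_lessThan)+
  have loop: "(x, x) \<notin> parcs G" for x
  proof -
    interpret pair_graph G by fact
    show ?thesis using pair_no_loops[of "(x, x)"] by auto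
  qed
  have parcs_H: "(vs ! i, vs ! j) \<in> parcs ?H \<longleftrightarrow> i \<noteq> j \<and> (vs ! i, vs ! j) \<notin> parcs G"
    if "i < n" "j < n" for i j
  proof -
    have "vs ! i \<in> pverts G" "vs ! j \<in> pverts G"
      using that len unfolding vs(2)[symmetric] by simp_all
    moreover have "vs ! i = vs ! j \<longleftrightarrow> i = j"
      using that len vs(1) by (simp add: nth_eq_iff_index_eq)
    ultimately show ?thesis
      by (simp add: complement_graph_def)
  qed
  have KL: "K \<subseteq> {..<n}" "L \<subseteq> {..<n}"
    using assms(4) by (auto simp: K_def L_def)
  have T: "(\<Sum>k\<in>K. (es ! k)\<^sup>2) + (\<Sum>k\<in>L. (fs ! k)\<^sup>2)
      \<le> (real n / 2 + sqrt (real s / 2))\<^sup>2"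
  proof (rule complementary_negative_energy_bound[OF u w KL(1) _ card(1) KL(2) _ card(2)])
    show "of_bool ((vs ! i, vs ! j) \<in> parcs G) + of_bool ((vs ! i, vs ! j) \<in> parcs ?H)
        = (1 :: real) - of_bool (i = j)" if "i < n" "j < n" for i j
      unfolding parcs_H[OF that] using loop by auto
  qed (simp_all add: K_def L_def)
  \<comment> \<open>Eigenvalues are numbered from 1, so number \<open>n - i + 1\<close> sits at
    position \<open>n - i\<close> of the decreasing list, which is position \<open>i - 1\<close> of
    its reversal.\<close>
  have nth: "graph_eigenvalue G (n - i + 1) = es ! (i - 1)"
    "graph_eigenvalue ?H (n - i + 1) = fs ! (i - 1)" if "i \<in> {1..s}" for i
    using that E(2) F(2) assms(4)
    by (auto simp: graph_eigenvalue_def es_def fs_def rev_nth)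
  have "(\<Sum>i = 1..s. (graph_eigenvalue G (n - i + 1))\<^sup>2 + (graph_eigenvalue ?H (n - i + 1))\<^sup>2)
      = (\<Sum>i = 1..s. (es ! (i - 1))\<^sup>2 + (fs ! (i - 1))\<^sup>2)"
    using nth by (intro sum.cong) auto
  also have "\<dots> = (\<Sum>k<s. (es ! k)\<^sup>2) + (\<Sum>k<s. (fs ! k)\<^sup>2)"
    by (simp add: sum.atLeast1_atMost_eq sum.distrib)
  \<comment> \<open>The nonnegative eigenvalues are removed for each graph separately, both traces
    being 0.\<close>
  also have "\<dots> \<le> (1 + (real s / real n)\<^sup>2) * ((\<Sum>k\<in>K. (es ! k)\<^sup>2) + (\<Sum>k\<in>L. (fs ! k)\<^sup>2))"
    using sorted_sum_zero_bottom_squares[OF E(1,2) _ E(3), of s]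
      sorted_sum_zero_bottom_squares[OF F(1,2) _ F(3), of s] assms(4)
    by (simp add: K_def L_def distrib_left)
  also have "\<dots> \<le> (1 + (real s / real n)\<^sup>2) * (real n / 2 + sqrt (real s / 2))\<^sup>2"
    using T by (intro mult_left_mono) auto
  also have "\<dots> \<le> (real n / 2 + real s)\<^sup>2"
    using assms by (intro bottom_squares_numeric_bound) auto
  finally show ?thesis .
qed

end
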